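(* In a $\dagger$-category with a zero object and finite $\dagger$-equalizers, the $\dagger$-functor is nondegenerate; that is, for every morphism $f:A\to B$, if $f;f^\dagger=0_{A,A}$ then $f=0_{A,B}$.
   Context: Composition is written in diagrammatic order: $f;g$ means first $f$, then $g$. A $\dagger$-category is a category with a contravariant endofunctor $\dagger$ (the $\dagger$-functor) that is the identity on objects and satisfies $(f^\dagger)^\dagger=f$. A zero object is an object that is both initial and terminal; $0_{A,B}:A\to B$ is the morphism factoring through it. A finite $\dagger$-equalizer is an equalizer $e:E\to A$ of a finite set of parallel morphisms $A\to B$ such that $e$ is an isometry, i.e. $e;e^\dagger=\mathrm{id}_E$. *)

theory Defs
  imports Main
begin

(* Composition is written in diagrammatic order: f \<Zcomp> g is first f, then g. *)
record ('o, 'a) cat =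
  Obj :: "'o set"
  Arr :: "'a set"
  Dom :: "'a \<Rightarrow> 'o"
  Cod :: "'a \<Rightarrow> 'o"
  Ident :: "'o \<Rightarrow> 'a"
  Comp :: "'a \<Rightarrow> 'a \<Rightarrow> 'a" (infixl "\<Zcomp>\<index>" 70)

definition Hom :: "('o, 'a, 'm) cat_scheme \<Rightarrow> 'o \<Rightarrow> 'o \<Rightarrow> 'a set" where
  "Hom C A B = {f \<in> Arr C. Dom C f = A \<and> Cod C f = B}"

locale category =
  fixes C (structure)
  assumes Dom_Obj: "f \<in> Arr C \<Longrightarrow> Dom C f \<in> Obj C"
    and Cod_Obj: "f \<in> Arr C \<Longrightarrow> Cod C f \<in> Obj C"
    and Ident_Hom: "A \<in> Obj C \<Longrightarrow> Ident C A \<in> Hom C A A"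
    and Comp_Hom: "f \<in> Hom C A B \<Longrightarrow> g \<in> Hom C B D \<Longrightarrow> f \<Zcomp> g \<in> Hom C A D"
    and Ident_left: "f \<in> Hom C A B \<Longrightarrow> Ident C A \<Zcomp> f = f"
    and Ident_right: "f \<in> Hom C A B \<Longrightarrow> f \<Zcomp> Ident C B = f"
    and Comp_assoc:
      "f \<in> Hom C A B \<Longrightarrow> g \<in> Hom C B D \<Longrightarrow> h \<in> Hom C D E \<Longrightarrow>
        (f \<Zcomp> g) \<Zcomp> h = f \<Zcomp> (g \<Zcomp> h)"

locale contravariant_endofunctor = category +
  fixes Fo :: "'a \<Rightarrow> 'a" and Fa :: "'b \<Rightarrow> 'b"
  assumes Fo_Obj: "A \<in> Obj C \<Longrightarrow> Fo A \<in> Obj C"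
    and Fa_Hom: "f \<in> Hom C A B \<Longrightarrow> Fa f \<in> Hom C (Fo B) (Fo A)"
    and Fa_Ident: "A \<in> Obj C \<Longrightarrow> Fa (Ident C A) = Ident C (Fo A)"
    and Fa_Comp: "f \<in> Hom C A B \<Longrightarrow> g \<in> Hom C B D \<Longrightarrow> Fa (f \<Zcomp> g) = Fa g \<Zcomp> Fa f"

record ('o, 'a) dagger_cat = "('o, 'a) cat" +
  Dagger :: "'a \<Rightarrow> 'a" ("_\<^sup>\<dagger>\<index>" [1000] 999)

locale dagger_category =
  fixes C (structure)
  assumes Dagger_functor: "contravariant_endofunctor C (\<lambda>A. A) (Dagger C)"
    and Dagger_Dagger: "f \<in> Arr C \<Longrightarrow> (f\<^sup>\<dagger>)\<^sup>\<dagger> = f"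

definition initial_object :: "('o, 'a, 'm) cat_scheme \<Rightarrow> 'o \<Rightarrow> bool" where
  "initial_object C Z \<longleftrightarrow> Z \<in> Obj C \<and> (\<forall>A\<in>Obj C. \<exists>!f. f \<in> Hom C Z A)"

definition terminal_object :: "('o, 'a, 'm) cat_scheme \<Rightarrow> 'o \<Rightarrow> bool" where
  "terminal_object C Z \<longleftrightarrow> Z \<in> Obj C \<and> (\<forall>A\<in>Obj C. \<exists>!f. f \<in> Hom C A Z)"

definition zero_object :: "('o, 'a, 'm) cat_scheme \<Rightarrow> 'o \<Rightarrow> bool" where
  "zero_object C Z \<longleftrightarrow> initial_object C Z \<and> terminal_object C Z"

(* Meaningful only if C has a zero object; independent of its choice, see zero_mor_eqI. *)
definition zero_mor :: "('o, 'a, 'm) cat_scheme \<Rightarrow> 'o \<Rightarrow> 'o \<Rightarrow> 'a" where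
  "zero_mor C A B =
    (THE f. \<exists>Z g h. zero_object C Z \<and> g \<in> Hom C A Z \<and> h \<in> Hom C Z B \<and> f = g \<Zcomp>\<^bsub>C\<^esub> h)"

definition equalizer ::
  "('o, 'a, 'm) cat_scheme \<Rightarrow> 'o \<Rightarrow> 'a set \<Rightarrow> 'o \<Rightarrow> 'a \<Rightarrow> bool" where
  "equalizer C A F E e \<longleftrightarrow>
    e \<in> Hom C E A \<and>
    (\<forall>f\<in>F. \<forall>g\<in>F. e \<Zcomp>\<^bsub>C\<^esub> f = e \<Zcomp>\<^bsub>C\<^esub> g) \<and>
    (\<forall>X h. h \<in> Hom C X A \<and> (\<forall>f\<in>F. \<forall>g\<in>F. h \<Zcomp>\<^bsub>C\<^esub> f = h \<Zcomp>\<^bsub>C\<^esub> g) \<longrightarrow>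
      (\<exists>!k. k \<in> Hom C X E \<and> k \<Zcomp>\<^bsub>C\<^esub> e = h))"

definition isometry :: "('o, 'a, 'm) dagger_cat_scheme \<Rightarrow> 'a \<Rightarrow> bool" where
  "isometry C e \<longleftrightarrow> e \<in> Arr C \<and> e \<Zcomp>\<^bsub>C\<^esub> e\<^sup>\<dagger>\<^bsub>C\<^esub> = Ident C (Dom C e)"

(* F may be empty; this is harmless, since the identity on A is then a dagger-equalizer. *)
definition has_finite_dagger_equalizers :: "('o, 'a, 'm) dagger_cat_scheme \<Rightarrow> bool" where
  "has_finite_dagger_equalizers C \<longleftrightarrow>
    (\<forall>A\<in>Obj C. \<forall>B\<in>Obj C. \<forall>F. finite F \<and> F \<subseteq> Hom C A B \<longrightarrow>
      (\<exists>E e. equalizer C A F E e \<and> isometry C e))"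

definition nondegenerate :: "('o, 'a, 'm) dagger_cat_scheme \<Rightarrow> bool" where
  "nondegenerate C \<longleftrightarrow>
    (\<forall>A\<in>Obj C. \<forall>B\<in>Obj C. \<forall>f\<in>Hom C A B.
      f \<Zcomp>\<^bsub>C\<^esub> f\<^sup>\<dagger>\<^bsub>C\<^esub> = zero_mor C A A \<longrightarrow> f = zero_mor C A B)"

lemma (in category) zero_mor_eqI:
  assumes Z: "zero_object C Z" and g: "g \<in> Hom C A Z" and h: "h \<in> Hom C Z B"
  shows "zero_mor C A B = g \<Zcomp> h"
  unfolding zero_mor_def
proof (rule the_equality)
  show "\<exists>Z' g' h'. zero_object C Z' \<and> g' \<in> Hom C A Z' \<and> h' \<in> Hom C Z' B \<and> g \<Zcomp> h = g' \<Zcomp> h'"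
    using assms by blast
next
  fix f assume "\<exists>Z' g' h'. zero_object C Z' \<and> g' \<in> Hom C A Z' \<and> h' \<in> Hom C Z' B \<and> f = g' \<Zcomp> h'"
  then obtain Z' g' h' where *: "zero_object C Z'" "g' \<in> Hom C A Z'" "h' \<in> Hom C Z' B"
      "f = g' \<Zcomp> h'"
    by blast
  have AB: "A \<in> Obj C" "B \<in> Obj C" "Z \<in> Obj C" "Z' \<in> Obj C"
    using g h *(1) Z Dom_Obj Cod_Obj
    by (auto simp: Hom_def zero_object_def initial_object_def)
  obtain u where u: "u \<in> Hom C Z Z'"
    using Z AB by (auto simp: zero_object_def initial_object_def)
  have "g \<Zcomp> u = g'"
    using *(1,2) AB Comp_Hom[OF g u] unfolding zero_object_def terminal_object_def by blast
  moreover have "u \<Zcomp> h' = h"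
    using Z h AB Comp_Hom[OF u *(3)] unfolding zero_object_def initial_object_def by blast
  ultimately show "f = g \<Zcomp> h"
    using Comp_assoc[OF g u *(3)] *(4) by simp
qed

end

theory Submission
  imports Defs
begin

text \<open>
  Let \<open>e\<close> be a \<open>\<dagger>\<close>-equalizer of \<open>f\<^sup>\<dagger>\<close> and \<open>0\<close>. Since \<open>f; f\<^sup>\<dagger> = 0\<close>, the morphism \<open>f\<close> factors
  as \<open>k; e\<close>. As \<open>e\<close> is an isometry, \<open>k = f; e\<^sup>\<dagger> = (e; f\<^sup>\<dagger>)\<^sup>\<dagger> = 0\<close>, and so \<open>f = 0\<close>.
\<close>

context category
begin

lemma Hom_Obj:
  assumes "f \<in> Hom C A B"
  shows "A \<in> Obj C" "B \<in> Obj C"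
  using assms Dom_Obj Cod_Obj by (auto simp: Hom_def)

text \<open>Replaces the definite description in \<open>zero_mor\<close> by a concrete composite
  through a fixed \<open>Z\<close>, which the absorption and dagger laws then manipulate.\<close>

lemma zero_mor_factors:
  assumes "zero_object C Z" "A \<in> Obj C" "B \<in> Obj C"
  obtains g h where "g \<in> Hom C A Z" "h \<in> Hom C Z B" "zero_mor C A B = g \<Zcomp> h"
proof -
  obtain g h where gh: "g \<in> Hom C A Z" "h \<in> Hom C Z B"
    using assms unfolding zero_object_def initial_object_def terminal_object_def by blast
  from that[OF gh zero_mor_eqI[OF assms(1) gh]] show thesis .
qed

lemma zero_mor_Hom:
  assumes "zero_object C Z" "A \<in> Obj C" "B \<in> Obj C"
  shows "zero_mor C A B \<in> Hom C A B"
  by (rule zero_mor_factors[OF assms]) (simp add: Comp_Hom)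

text \<open>Reassociating lets \<open>f\<close> be absorbed into the leg entering \<open>Z\<close>;
  the result still factors through \<open>Z\<close>, so \<open>zero_mor_eqI\<close> identifies
  it.\<close>

lemma Comp_zero_mor:
  assumes "zero_object C Z" "f \<in> Hom C A B" "D \<in> Obj C"
  shows "f \<Zcomp> zero_mor C B D = zero_mor C A D"
proof -
  obtain g h where gh: "g \<in> Hom C B Z" "h \<in> Hom C Z D" "zero_mor C B D = g \<Zcomp> h"
    using zero_mor_factors[OF assms(1) Hom_Obj(2)[OF assms(2)] assms(3)] .
  show ?thesis
    using zero_mor_eqI[OF assms(1) Comp_Hom[OF assms(2) gh(1)] gh(2)]
      Comp_assoc[OF assms(2) gh(1,2)] gh(3) by simp
qed

lemma zero_mor_Comp:
  assumes "zero_object C Z" "A \<in> Obj C" "f \<in> Hom C B D"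
  shows "zero_mor C A B \<Zcomp> f = zero_mor C A D"
proof -
  obtain g h where gh: "g \<in> Hom C A Z" "h \<in> Hom C Z B" "zero_mor C A B = g \<Zcomp> h"
    using zero_mor_factors[OF assms(1,2) Hom_Obj(1)[OF assms(3)]] .
  show ?thesis
    using zero_mor_eqI[OF assms(1) gh(1) Comp_Hom[OF gh(2) assms(3)]]
      Comp_assoc[OF gh(1,2) assms(3)] gh(3) by simp
qed

end

context dagger_category
begin

sublocale contravariant_endofunctor C "\<lambda>A. A" "Dagger C"
  by (rule Dagger_functor)

text \<open>Contravariance swaps the two legs at \<open>Z\<close>, giving a factorization through
  \<open>Z\<close> in the opposite direction.\<close>

lemma Dagger_zero_mor:
  assumes "zero_object C Z" "A \<in> Obj C" "B \<in> Obj C"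
  shows "(zero_mor C A B)\<^sup>\<dagger> = zero_mor C B A"
proof -
  obtain g h where gh: "g \<in> Hom C A Z" "h \<in> Hom C Z B" "zero_mor C A B = g \<Zcomp> h"
    using zero_mor_factors[OF assms] .
  show ?thesis
    using zero_mor_eqI[OF assms(1) Fa_Hom[OF gh(2)] Fa_Hom[OF gh(1)]]
      Fa_Comp[OF gh(1,2)] gh(3) by simp
qed

lemma Comp_Dagger_eq_zero_mor_imp:
  assumes Z: "zero_object C Z" and eqs: "has_finite_dagger_equalizers C"
    and f: "f \<in> Hom C A B" and ff: "f \<Zcomp> f\<^sup>\<dagger> = zero_mor C A A"
  shows "f = zero_mor C A B"
proof -
  note A = Hom_Obj(1)[OF f] and B = Hom_Obj(2)[OF f]
  have fd: "f\<^sup>\<dagger> \<in> Hom C B A"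
    using Fa_Hom[OF f] .
  then have "finite {f\<^sup>\<dagger>, zero_mor C B A}" "{f\<^sup>\<dagger>, zero_mor C B A} \<subseteq> Hom C B A"
    using zero_mor_Hom[OF Z B A] by auto
  then obtain E e where eq: "equalizer C B {f\<^sup>\<dagger>, zero_mor C B A} E e" and iso: "isometry C e"
    using eqs[unfolded has_finite_dagger_equalizers_def, rule_format, OF B A] by blast
  have e: "e \<in> Hom C E B" and ef: "e \<Zcomp> f\<^sup>\<dagger> = e \<Zcomp> zero_mor C B A"
    using eq unfolding equalizer_def by blast+
  note E = Hom_Obj(1)[OF e]
  \<comment> \<open>Both composites are \<open>zero_mor C A A\<close>: one by hypothesis, the other
    by absorption.\<close>
  have "\<forall>x\<in>{f\<^sup>\<dagger>, zero_mor C B A}. \<forall>y\<in>{f\<^sup>\<dagger>, zero_mor C B A}. f \<Zcomp> x = f \<Zcomp> y"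
    using ff Comp_zero_mor[OF Z f A] by simp
  then obtain k where k: "k \<in> Hom C A E" "k \<Zcomp> e = f"
    using eq f unfolding equalizer_def by blast
  have "k = k \<Zcomp> (e \<Zcomp> e\<^sup>\<dagger>)"
    using iso e Ident_right[OF k(1)] by (simp add: isometry_def Hom_def)
  also have "\<dots> = f \<Zcomp> e\<^sup>\<dagger>"
    using Comp_assoc[OF k(1) e Fa_Hom[OF e]] k(2) by simp
  \<comment> \<open>The involution law restores \<open>f\<close> from its double dagger, exposing
    the composite that the equalizer controls.\<close>
  also have "\<dots> = (e \<Zcomp> f\<^sup>\<dagger>)\<^sup>\<dagger>"
    using Fa_Comp[OF e fd] Dagger_Dagger f by (simp add: Hom_def)
  \<comment> \<open>The inner composite is \<open>zero_mor C E A\<close>, since \<open>e\<close>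
    equalizes; the outer dagger reverses its endpoints.\<close>
  also have "\<dots> = zero_mor C A E"
    using ef Comp_zero_mor[OF Z e A] Dagger_zero_mor[OF Z E A] by simp
  finally show ?thesis
    using k(2) zero_mor_Comp[OF Z A e] by simp
qed

end

theorem lemma2p5:
  fixes C :: "('o, 'a, 'm) dagger_cat_scheme"
  assumes "dagger_category C"
    and "\<exists>Z. zero_object C Z"
    and "has_finite_dagger_equalizers C"
  shows "nondegenerate C"
proof -
  interpret dagger_category C
    by (fact assms(1))
  show ?thesis
    using assms(2,3) Comp_Dagger_eq_zero_mor_imp unfolding nondegenerate_def by meson
qed

end
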